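(* Let $p$ be a prime and $G$ a finite $p$-group, not elementary abelian, acting by ring automorphisms on a ring $R$, and assume that for each proper subgroup $H$ of $G$ there is $x_H\in R$ with $N_H(x_H)=1$. Let $U$ be a normal subgroup of index $p$ in $G$ and let $\sigma\in G$ be an element whose class generates $G/U$. Let $\alpha:G\to B$ be the map defined in the context, let $b:G\to R$ be a map such that $\alpha-b:G\to B$ is a $1$-cocycle, and let $w\in R$ be such that $b(g)=(g-1)(w)$ for all $g\in U$. Then the element $$a=b(\sigma)+(1-\sigma)(w)\in R$$ is $U$-invariant and $N_{G/U}(a)=(1+\sigma+\cdots+\sigma^{p-1})(a)=1$.
   Context: Rings are associative with unit, not necessarily commutative; $N_H(r)=\sum_{g\in H}g(r)$; an elementary abelian group is one isomorphic to $C_q^r$, $q$ prime, $r\ge1$. For a left $G$-module $M$, a $1$-cocycle is a map $\beta:G\to M$ with $\beta(gh)=\beta(g)+g\beta(h)$ for all $g,h\in G$. $B=\mathrm{Hom}_{\mathbf Z}(\mathbf Z[G],R)$ with left $G$-action $(g\varphi)(s)=\varphi(sg)$ for $g,s\in G$. $R$ is viewed as a $G$-submodule of $B$ by identifying $r\in R$ with $\varphi_r\in B$, $\varphi_r(g)=g(r)$ for $g\in G$; thus $\alpha-b$ means $g\mapsto\alpha(g)-\varphi_{b(g)}$. The element $\varphi\in B$ is defined by $\varphi(g)=1$ if $g\in U$ and $\varphi(g)=0$ for $g\in G\setminus U$; it is $U$-invariant. The map $\alpha:G\to B$ is defined as follows: if $g\in\sigma^kU$ with $0\le k\le p-1$,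 then $\alpha(g)=0$ for $k=0$ and $\alpha(g)=(1+\sigma+\cdots+\sigma^{k-1})\varphi$ for $1\le k\le p-1$. *)

theory Defs
  imports "HOL-Algebra.Algebra" "HOL-Algebra.Free_Abelian_Groups"
begin

definition elementary_abelian :: "('g, 'm) monoid_scheme \<Rightarrow> bool" where
  "elementary_abelian G \<longleftrightarrow>
     (\<exists>(q::nat) (r::nat). Factorial_Ring.prime q \<and> 1 \<le> r \<and> G \<cong> product_group {..<r} (\<lambda>_. integer_mod_group q))"

definition ring_aut_action ::
    "('g, 'm) monoid_scheme \<Rightarrow> ('r, 'n) ring_scheme \<Rightarrow> ('g \<Rightarrow> 'r \<Rightarrow> 'r) \<Rightarrow> bool" where
  "ring_aut_action G R act \<longleftrightarrow>
     group_action G (carrier R) act \<and> (\<forall>g\<in>carrier G. act g \<in> ring_iso R R)"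

definition norm_map ::
    "('r, 'n) ring_scheme \<Rightarrow> ('g \<Rightarrow> 'r \<Rightarrow> 'r) \<Rightarrow> 'g set \<Rightarrow> 'r \<Rightarrow> 'r" where
  "norm_map R act H r = (\<Oplus>\<^bsub>R\<^esub>g\<in>H. act g r)"

text \<open>The action of a quotient \<open>G / U\<close> on the \<open>U\<close>-invariants: a coset acts through any of its
  elements, so \<open>quot_act act C r\<close> is meaningful only for \<open>U\<close>-invariant \<open>r\<close>.\<close>

definition quot_act :: "('g \<Rightarrow> 'r \<Rightarrow> 'r) \<Rightarrow> 'g set \<Rightarrow> 'r \<Rightarrow> 'r" where
  "quot_act act C r = act (SOME g. g \<in> C) r"

text \<open>The additive group of a \<open>G\<close>-module is a \<open>monoid\<close> record, written multiplicatively
  as in the library's \<^const>\<open>free_Abelian_group\<close>: \<open>\<otimes>\<close> below is addition of the module.\<close>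

definition one_cocycle ::
    "('g, 'm) monoid_scheme \<Rightarrow> ('b, 'n) monoid_scheme \<Rightarrow> ('g \<Rightarrow> 'b \<Rightarrow> 'b) \<Rightarrow> ('g \<Rightarrow> 'b) \<Rightarrow> bool" where
  "one_cocycle G M act \<beta> \<longleftrightarrow>
     \<beta> \<in> carrier G \<rightarrow> carrier M \<and>
     (\<forall>g\<in>carrier G. \<forall>h\<in>carrier G. \<beta> (g \<otimes>\<^bsub>G\<^esub> h) = \<beta> g \<otimes>\<^bsub>M\<^esub> act g (\<beta> h))"

text \<open>The additive group of the integral group ring, and right multiplication by \<open>g\<close> on it.
  The group element \<open>s\<close> is the basis vector \<open>frag_of s\<close>.\<close>

abbreviation ZG :: "('g, 'm) monoid_scheme \<Rightarrow> ('g \<Rightarrow>\<^sub>0 int) monoid" where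
  "ZG G \<equiv> free_Abelian_group (carrier G)"

definition ZG_rmult :: "('g, 'm) monoid_scheme \<Rightarrow> ('g \<Rightarrow>\<^sub>0 int) \<Rightarrow> 'g \<Rightarrow> ('g \<Rightarrow>\<^sub>0 int)" where
  "ZG_rmult G x g = frag_extend (\<lambda>s. frag_of (s \<otimes>\<^bsub>G\<^esub> g)) x"

text \<open>\<open>coind G R\<close> is \<open>B = Hom(Z[G], R)\<close> under pointwise addition. Homomorphisms are taken
  extensional, so that equality in \<open>B\<close> is equality of functions on \<open>Z[G]\<close>.\<close>

definition coind :: "('g, 'm) monoid_scheme \<Rightarrow> ('r, 'n) ring_scheme \<Rightarrow> (('g \<Rightarrow>\<^sub>0 int) \<Rightarrow> 'r) monoid" where
  "coind G R =
     \<lparr>carrier = hom (ZG G) (add_monoid R) \<inter> extensional (carrier (ZG G)),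
      monoid.mult = (\<lambda>\<phi> \<psi>. \<lambda>x\<in>carrier (ZG G). \<phi> x \<oplus>\<^bsub>R\<^esub> \<psi> x),
      one = (\<lambda>x\<in>carrier (ZG G). \<zero>\<^bsub>R\<^esub>)\<rparr>"

definition coind_act ::
    "('g, 'm) monoid_scheme \<Rightarrow> ('r, 'n) ring_scheme \<Rightarrow> 'g \<Rightarrow>
     (('g \<Rightarrow>\<^sub>0 int) \<Rightarrow> 'r) \<Rightarrow> (('g \<Rightarrow>\<^sub>0 int) \<Rightarrow> 'r)" where
  "coind_act G R g = (\<lambda>\<phi>\<in>carrier (coind G R). \<lambda>x\<in>carrier (ZG G). \<phi> (ZG_rmult G x g))"

text \<open>The element of \<open>B\<close> with prescribed values \<open>f\<close> on the basis \<open>G\<close> of \<open>Z[G]\<close>.\<close>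

definition lin_ext ::
    "('g, 'm) monoid_scheme \<Rightarrow> ('r, 'n) ring_scheme \<Rightarrow> ('g \<Rightarrow> 'r) \<Rightarrow> (('g \<Rightarrow>\<^sub>0 int) \<Rightarrow> 'r)" where
  "lin_ext G R f =
     (\<lambda>x\<in>carrier (ZG G). \<Oplus>\<^bsub>R\<^esub>s\<in>Poly_Mapping.keys x. [Poly_Mapping.lookup x s] \<cdot>\<^bsub>R\<^esub> f s)"

definition coind_embed ::
    "('g, 'm) monoid_scheme \<Rightarrow> ('r, 'n) ring_scheme \<Rightarrow> ('g \<Rightarrow> 'r \<Rightarrow> 'r) \<Rightarrow> 'r \<Rightarrow> (('g \<Rightarrow>\<^sub>0 int) \<Rightarrow> 'r)" where
  "coind_embed G R act r = lin_ext G R (\<lambda>g. act g r)"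

definition phi_elt ::
    "('g, 'm) monoid_scheme \<Rightarrow> ('r, 'n) ring_scheme \<Rightarrow> 'g set \<Rightarrow> (('g \<Rightarrow>\<^sub>0 int) \<Rightarrow> 'r)" where
  "phi_elt G R U = lin_ext G R (\<lambda>g. if g \<in> U then \<one>\<^bsub>R\<^esub> else \<zero>\<^bsub>R\<^esub>)"

text \<open>\<open>coset_exp G U p \<sigma> g\<close> is the \<open>k < p\<close> with \<open>g \<in> \<sigma>\<^sup>k U\<close>; it is unique when \<open>\<sigma>\<close> generates
  \<open>G / U\<close> and \<open>U\<close> has index \<open>p\<close>. The product in \<open>alpha_map\<close> is the sum
  \<open>(1 + \<sigma> + \<dots> + \<sigma>\<^sup>k\<^sup>-\<^sup>1) \<phi>\<close> in \<open>B\<close>, which is \<open>0\<close> for \<open>k = 0\<close>.\<close>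

definition coset_exp :: "('g, 'm) monoid_scheme \<Rightarrow> 'g set \<Rightarrow> nat \<Rightarrow> 'g \<Rightarrow> 'g \<Rightarrow> nat" where
  "coset_exp G U p \<sigma> g = (THE k. k < p \<and> g \<in> (\<sigma> [^]\<^bsub>G\<^esub> k) <#\<^bsub>G\<^esub> U)"

definition alpha_map ::
    "('g, 'm) monoid_scheme \<Rightarrow> ('r, 'n) ring_scheme \<Rightarrow> 'g set \<Rightarrow> nat \<Rightarrow> 'g \<Rightarrow> 'g \<Rightarrow>
     (('g \<Rightarrow>\<^sub>0 int) \<Rightarrow> 'r)" where
  "alpha_map G R U p \<sigma> g =
     (\<Otimes>\<^bsub>coind G R\<^esub>i\<in>{..<coset_exp G U p \<sigma> g}. coind_act G R (\<sigma> [^]\<^bsub>G\<^esub> i) (phi_elt G R U))"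

end

theory Submission
  imports Defs
begin

text \<open>Evaluating the cocycle identity for \<open>\<alpha> - b\<close> at the unit of \<open>G\<close> turns it into
  \<open>b(gh) = b(g) + g b(h) - c(g, h)\<close>, where \<open>c(g, h) = \<alpha>(g)(1) + \<alpha>(h)(g) - \<alpha>(gh)(1)\<close> is the
  carry that occurs when the exponents of the cosets of \<open>g\<close> and \<open>h\<close> are added modulo \<open>p\<close>.
  The map \<open>d(g) = b(g) - (g - 1)(w)\<close> satisfies the same identity, vanishes on \<open>U\<close>, and takes the
  value \<open>a\<close> at \<open>\<sigma>\<close>. Since no carry occurs when a factor lies in \<open>U\<close>, comparing
  \<open>d(u\<sigma>) = u a\<close> with \<open>d(\<sigma>u') = a\<close> for \<open>u\<sigma> = \<sigma>u'\<close> gives invariance. Along the powers of \<open>\<sigma>\<close> the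
  only carry up to \<open>\<sigma>\<^sup>p\<close> is at the last step, so \<open>0 = d(\<sigma>\<^sup>p) = (1 + \<sigma> + \<dots> + \<sigma>\<^sup>p\<^sup>-\<^sup>1)(a) - 1\<close>.\<close>

text \<open>The index set may be infinite. Both products are then the unit by default, so
  preservation of the unit settles this case as well as the empty one.\<close>

lemma finprod_hom:
  assumes "comm_monoid M" "comm_group N" "h \<in> hom M N" "h \<one>\<^bsub>M\<^esub> = \<one>\<^bsub>N\<^esub>" "f \<in> A \<rightarrow> carrier M"
  shows "h (finprod M f A) = finprod N (\<lambda>x. h (f x)) A"
proof -
  interpret M: comm_monoid M by fact
  interpret N: comm_group N by fact
  show ?thesis
    using assms(5)
  proof (induction A rule: infinite_finite_induct)
    case (insert x A)
    have "(\<lambda>x. h (f x)) \<in> A \<rightarrow> carrier N" "h (f x) \<in> carrier N"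
      using insert.prems hom_in_carrier[OF assms(3)] by blast+
    with insert show ?case
      using hom_mult[OF assms(3)] by (auto simp: Pi_iff)
  qed (use assms(4) in auto)
qed

text \<open>Passes from b to d in the cocycle identity. Here \<open>x\<close>, \<open>y\<close>,
  \<open>z\<close> stand for \<alpha>(gh)(1), \<alpha>(g)(1), \<alpha>(h)(g), while
  \<open>b\<close>, \<open>b1\<close>, \<open>b2\<close> stand for b(gh), b(g), g b(h), and
  \<open>w1\<close>, \<open>w2\<close> for the translates of \<open>w\<close> by g and gh. The
  coboundary terms telescope: the differences \<open>w1 - w\<close> and \<open>w2 - w1\<close> add
  up to \<open>w2 - w\<close>.\<close>

lemma (in ring) coboundary_shift:
  assumes "x \<ominus> b = (y \<ominus> b1) \<oplus> (z \<ominus> b2)"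
    and cl: "x \<in> carrier R" "y \<in> carrier R" "z \<in> carrier R" "b \<in> carrier R" "b1 \<in> carrier R"
      "b2 \<in> carrier R" "w \<in> carrier R" "w1 \<in> carrier R" "w2 \<in> carrier R"
  shows "(b \<ominus> (w2 \<ominus> w)) \<oplus> (y \<oplus> z)
    = (b1 \<ominus> (w1 \<ominus> w)) \<oplus> (b2 \<ominus> (w2 \<ominus> w1)) \<oplus> x"
proof -
  have "x = (x \<ominus> b) \<oplus> b"
    using cl by algebra
  then have "x = (y \<ominus> b1) \<oplus> (z \<ominus> b2) \<oplus> b"
    by (simp only: assms(1))
  then show ?thesis
    using cl by algebra
qed

section \<open>The coinduced module B and evaluation at basis vectors\<close>

context
  fixes G :: "('g, 'm) monoid_scheme" (structure) and R :: "('r, 'n) ring_scheme"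
  assumes G: "group G" and R: "ring R"
begin

interpretation G: group G by (rule G)
interpretation R: ring R by (rule R)

lemma in_coind_iff:
  "\<phi> \<in> carrier (coind G R) \<longleftrightarrow>
     \<phi> \<in> hom (ZG G) (add_monoid R) \<and> \<phi> \<in> extensional (carrier (ZG G))"
  by (simp add: coind_def)

lemma coind_mult: "\<phi> \<otimes>\<^bsub>coind G R\<^esub> \<psi> = (\<lambda>x\<in>carrier (ZG G). \<phi> x \<oplus>\<^bsub>R\<^esub> \<psi> x)"
  and coind_one: "\<one>\<^bsub>coind G R\<^esub> = (\<lambda>x\<in>carrier (ZG G). \<zero>\<^bsub>R\<^esub>)"
  by (simp_all add: coind_def)

lemma ZG_add_closed: "x \<in> carrier (ZG G) \<Longrightarrow> y \<in> carrier (ZG G) \<Longrightarrow> x + y \<in> carrier (ZG G)"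
  by (metis G.group_axioms group.is_monoid group_free_Abelian_group monoid.m_closed mult_free_Abelian_group)

lemma coindI:
  assumes "\<And>x. x \<in> carrier (ZG G) \<Longrightarrow> f x \<in> carrier R"
    and "\<And>x y. x \<in> carrier (ZG G) \<Longrightarrow> y \<in> carrier (ZG G) \<Longrightarrow> f (x + y) = f x \<oplus>\<^bsub>R\<^esub> f y"
  shows "(\<lambda>x\<in>carrier (ZG G). f x) \<in> carrier (coind G R)"
  using assms ZG_add_closed
  by (auto simp: in_coind_iff hom_def simp del: carrier_free_Abelian_group_iff)

lemma coindD:
  assumes "\<phi> \<in> carrier (coind G R)"
  shows "x \<in> carrier (ZG G) \<Longrightarrow> \<phi> x \<in> carrier R"
    and "x \<in> carrier (ZG G) \<Longrightarrow> y \<in> carrier (ZG G) \<Longrightarrow> \<phi> (x + y) = \<phi> x \<oplus>\<^bsub>R\<^esub> \<phi> y"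
    and "\<phi> \<in> extensional (carrier (ZG G))"
  using assms by (auto simp: in_coind_iff hom_def Pi_iff)

lemma comm_group_coind: "comm_group (coind G R)"
proof (rule comm_groupI)
  fix \<phi> \<psi> assume *: "\<phi> \<in> carrier (coind G R)" "\<psi> \<in> carrier (coind G R)"
  show "\<phi> \<otimes>\<^bsub>coind G R\<^esub> \<psi> \<in> carrier (coind G R)"
    unfolding coind_mult
    by (rule coindI) (use coindD[OF *(1)] coindD[OF *(2)] in
        \<open>simp_all add: R.a_ac del: carrier_free_Abelian_group_iff\<close>)
  show "\<phi> \<otimes>\<^bsub>coind G R\<^esub> \<psi> = \<psi> \<otimes>\<^bsub>coind G R\<^esub> \<phi>"
    unfolding coind_mult
    by (rule restrict_ext) (use coindD[OF *(1)] coindD[OF *(2)] R.a_comm in blast)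
next
  show "\<one>\<^bsub>coind G R\<^esub> \<in> carrier (coind G R)"
    unfolding coind_one by (rule coindI) auto
next
  fix \<phi> \<psi> \<chi>
  assume *: "\<phi> \<in> carrier (coind G R)" "\<psi> \<in> carrier (coind G R)" "\<chi> \<in> carrier (coind G R)"
  show "\<phi> \<otimes>\<^bsub>coind G R\<^esub> \<psi> \<otimes>\<^bsub>coind G R\<^esub> \<chi> = \<phi> \<otimes>\<^bsub>coind G R\<^esub> (\<psi> \<otimes>\<^bsub>coind G R\<^esub> \<chi>)"
    unfolding coind_mult
    by (rule restrict_ext) (use *[THEN coindD(1)] R.a_assoc in
        \<open>simp del: carrier_free_Abelian_group_iff\<close>)
next
  fix \<phi> assume *: "\<phi> \<in> carrier (coind G R)"
  \<comment> \<open>The right-hand side is \<phi> itself and not a restricted function, so its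
    extensionality is what turns agreement on Z[G] into equality.\<close>
  show "\<one>\<^bsub>coind G R\<^esub> \<otimes>\<^bsub>coind G R\<^esub> \<phi> = \<phi>"
    unfolding coind_mult coind_one
    by (rule extensionalityI[OF restrict_extensional coindD(3)[OF *]])
      (use coindD(1)[OF *] in \<open>simp del: carrier_free_Abelian_group_iff\<close>)
  show "\<exists>\<psi>\<in>carrier (coind G R). \<psi> \<otimes>\<^bsub>coind G R\<^esub> \<phi> = \<one>\<^bsub>coind G R\<^esub>"
  proof
    show "(\<lambda>x\<in>carrier (ZG G). \<ominus>\<^bsub>R\<^esub> \<phi> x) \<in> carrier (coind G R)"
      by (rule coindI) (use coindD[OF *] in
          \<open>simp_all add: R.minus_add del: carrier_free_Abelian_group_iff\<close>)
    show "(\<lambda>x\<in>carrier (ZG G). \<ominus>\<^bsub>R\<^esub> \<phi> x) \<otimes>\<^bsub>coind G R\<^esub> \<phi> = \<one>\<^bsub>coind G R\<^esub>"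
      unfolding coind_mult coind_one
      by (rule restrict_ext) (use coindD(1)[OF *] R.l_neg in
          \<open>simp del: carrier_free_Abelian_group_iff\<close>)
  qed
qed

text \<open>Lets sums and negatives in B be computed in \<open>R\<close>, one basis vector at a
  time; the main proof uses elements of B only through such values.\<close>

lemma coind_eval_hom:
  assumes "s \<in> carrier G"
  shows "(\<lambda>\<phi>. \<phi> (frag_of s)) \<in> hom (coind G R) (add_monoid R)"
  using assms by (auto simp: hom_def coind_mult intro!: coindD(1))

lemma coind_eval_mult:
  "s \<in> carrier G \<Longrightarrow> (\<phi> \<otimes>\<^bsub>coind G R\<^esub> \<psi>) (frag_of s) = \<phi> (frag_of s) \<oplus>\<^bsub>R\<^esub> \<psi> (frag_of s)"
  by (simp add: coind_mult)

lemma coind_eval_inv: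
  assumes "s \<in> carrier G" "\<phi> \<in> carrier (coind G R)"
  shows "(inv\<^bsub>coind G R\<^esub> \<phi>) (frag_of s) = \<ominus>\<^bsub>R\<^esub> \<phi> (frag_of s)"
proof -
  have "group_hom (coind G R) (add_monoid R) (\<lambda>\<phi>. \<phi> (frag_of s))"
    using comm_group_coind R.a_group coind_eval_hom[OF assms(1)]
    by (simp add: group_hom_def group_hom_axioms_def comm_group_def)
  then show ?thesis
    using group_hom.hom_inv[OF _ assms(2)] by (simp add: a_inv_def)
qed

lemma coind_eval_finprod:
  assumes "s \<in> carrier G" "f \<in> A \<rightarrow> carrier (coind G R)"
  shows "(finprod (coind G R) f A) (frag_of s) = (\<Oplus>\<^bsub>R\<^esub>i\<in>A. f i (frag_of s))"
  unfolding finsum_def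
  by (rule finprod_hom[OF comm_group.axioms(1)[OF comm_group_coind] R.a_comm_group
        coind_eval_hom[OF assms(1)] _ assms(2)])
    (simp add: coind_one assms(1))

lemma ZG_rmult_frag_of [simp]: "ZG_rmult G (frag_of s) g = frag_of (s \<otimes> g)"
  by (simp add: ZG_rmult_def)

lemma ZG_rmult_closed:
  assumes "x \<in> carrier (ZG G)" "g \<in> carrier G"
  shows "ZG_rmult G x g \<in> carrier (ZG G)"
  using assms keys_frag_extend[of "\<lambda>s. frag_of (s \<otimes> g)" x]
  by (auto simp: ZG_rmult_def keys_frag_of)

lemma coind_act_eval:
  assumes "\<phi> \<in> carrier (coind G R)" "g \<in> carrier G" "s \<in> carrier G"
  shows "coind_act G R g \<phi> (frag_of s) = \<phi> (frag_of (s \<otimes> g))"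
  using assms by (simp add: coind_act_def)

text \<open>Right multiplication by g on Z[G] extends a map of basis vectors additively, so
  precomposition with it preserves homomorphisms.\<close>

lemma coind_act_closed:
  assumes "\<phi> \<in> carrier (coind G R)" "g \<in> carrier G"
  shows "coind_act G R g \<phi> \<in> carrier (coind G R)"
  unfolding coind_act_def restrict_apply'[OF assms(1)]
  using coindD[OF assms(1)] ZG_rmult_closed[OF _ assms(2)]
  by (intro coindI) (simp_all add: ZG_rmult_def frag_extend_add del: carrier_free_Abelian_group_iff)

lemma lin_ext_frag_of:
  assumes "s \<in> carrier G" "f \<in> carrier G \<rightarrow> carrier R"
  shows "lin_ext G R f (frag_of s) = f s"
proof -
  have "f s \<in> carrier R" using assms by blast
  then show ?thesis
    using assms(1) by (simp add: lin_ext_def keys_frag_of R.add.int_pow_1)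
qed

text \<open>The sum defining \<open>lin_ext\<close> runs over the support of its argument, which
  changes under addition. As G is finite, the sum can be taken over all of G, the extra terms having
  coefficient 0; additivity is then termwise.\<close>

lemma lin_ext_closed:
  assumes fin: "finite (carrier G)" and f: "f \<in> carrier G \<rightarrow> carrier R"
  shows "lin_ext G R f \<in> carrier (coind G R)"
proof -
  define F where "F x = (\<Oplus>\<^bsub>R\<^esub>s\<in>carrier G. [Poly_Mapping.lookup x s] \<cdot>\<^bsub>R\<^esub> f s)" for x :: "'g \<Rightarrow>\<^sub>0 int"
  have cl: "(\<lambda>s. [Poly_Mapping.lookup x s] \<cdot>\<^bsub>R\<^esub> f s) \<in> carrier G \<rightarrow> carrier R" for x :: "'g \<Rightarrow>\<^sub>0 int"
    using f by (auto simp: R.add.int_pow_closed Pi_iff)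
  have "lin_ext G R f = (\<lambda>x\<in>carrier (ZG G). F x)"
    unfolding lin_ext_def F_def
  proof (rule restrict_ext)
    fix x assume "x \<in> carrier (ZG G)"
    then show "(\<Oplus>\<^bsub>R\<^esub>s\<in>Poly_Mapping.keys x. [Poly_Mapping.lookup x s] \<cdot>\<^bsub>R\<^esub> f s) =
               (\<Oplus>\<^bsub>R\<^esub>s\<in>carrier G. [Poly_Mapping.lookup x s] \<cdot>\<^bsub>R\<^esub> f s)"
      using cl[of x] fin
      by (intro R.add.finprod_mono_neutral_cong_left)
        (auto simp: in_keys_iff add_pow_def)
  qed
  moreover have "(\<lambda>x\<in>carrier (ZG G). F x) \<in> carrier (coind G R)"
  proof (rule coindI)
    show "F x \<in> carrier R" for x
      unfolding F_def using cl[of x] by (rule R.finsum_closed)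
    show "F (x + y) = F x \<oplus>\<^bsub>R\<^esub> F y" for x y
    proof -
      have "F (x + y) = (\<Oplus>\<^bsub>R\<^esub>s\<in>carrier G. [Poly_Mapping.lookup x s] \<cdot>\<^bsub>R\<^esub> f s
              \<oplus>\<^bsub>R\<^esub> [Poly_Mapping.lookup y s] \<cdot>\<^bsub>R\<^esub> f s)"
        unfolding F_def using f cl[of x] cl[of y]
        by (intro R.finsum_cong') (auto simp: lookup_add R.add.int_pow_mult Pi_iff)
      also have "\<dots> = F x \<oplus>\<^bsub>R\<^esub> F y"
        unfolding F_def using cl[of x] cl[of y] by (rule R.finsum_addf)
      finally show ?thesis .
    qed
  qed
  ultimately show ?thesis by simp
qed

end

section \<open>Powers of a generator of a finite cyclic quotient\<close>

context normal
begin

text \<open>A generator of a finite group has order equal to the size of the group, so the coset of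
  \<sigma> has order \<open>p\<close>. Its first \<open>p\<close> powers are therefore distinct and
  exhaust the quotient.\<close>

lemma cyclic_quotient_exponent:
  assumes fin: "finite (carrier G)" and card: "card (rcosets H) = p"
    and \<sigma>: "\<sigma> \<in> carrier G"
    and gen: "generate (G Mod H) {H #> \<sigma>} = carrier (G Mod H)"
  shows "bij_betw (\<lambda>i. H #> \<sigma> [^] i) {..<p} (carrier (G Mod H))"
    and "\<sigma> [^] (i::nat) \<in> H \<longleftrightarrow> p dvd i"
    and "g \<in> carrier G \<Longrightarrow> \<exists>!k. k < p \<and> g \<in> (\<sigma> [^] k) <# H"
proof -
  interpret Q: group "G Mod H" by (rule factorgroup_is_group)
  have carr: "carrier (G Mod H) = rcosets H" by (simp add: FactGroup_def)
  have \<sigma>Q: "H #> \<sigma> \<in> carrier (G Mod H)" using \<sigma> by (auto simp: carrier_FactGroup)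
  have pow: "(H #> \<sigma>) [^]\<^bsub>G Mod H\<^esub> k = H #> \<sigma> [^] k" for k :: nat
    using FactGroup_pow[OF \<sigma>] .
  have ord: "Q.ord (H #> \<sigma>) = p"
    using Q.generate_pow_card[OF \<sigma>Q] gen card carr by simp
  have finQ: "finite (carrier (G Mod H))"
    using fin by (simp add: carrier_FactGroup)
  then have "p \<noteq> 0"
    using card carr \<sigma>Q card_gt_0_iff by fastforce
  have inH: "H #> g = H \<longleftrightarrow> g \<in> H" if "g \<in> carrier G" for g
    using that coset_join1 coset_join2 is_subgroup subset by blast
  show dvd: "\<sigma> [^] i \<in> H \<longleftrightarrow> p dvd i" for i :: nat
    using Q.pow_eq_id[OF \<sigma>Q, of i] inH[of "\<sigma> [^] i"] \<sigma> by (simp add: pow ord)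
  \<comment> \<open>\<open>Q.ord_inj\<close> gives injectivity on the exponents from 0 to
    \<open>p - 1\<close>; with truncated subtraction this range is \<open>{..<p}\<close> only
    because \<open>p\<close> is nonzero.\<close>
  have inj: "inj_on (\<lambda>i. H #> \<sigma> [^] i) {..<p}"
    using Q.ord_inj[OF \<sigma>Q] \<open>p \<noteq> 0\<close>
    by (simp add: ord pow atLeast0AtMost) (metis (no_types, lifting) Suc_pred atLeast0AtMost lessThan_Suc_atMost neq0_conv)
  show bij: "bij_betw (\<lambda>i. H #> \<sigma> [^] i) {..<p} (carrier (G Mod H))"
    unfolding bij_betw_def
  proof
    have "(\<lambda>i. H #> \<sigma> [^] i) ` {..<p} \<subseteq> carrier (G Mod H)"
      using \<sigma> by (auto simp: carrier_FactGroup)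
    moreover have "card ((\<lambda>i. H #> \<sigma> [^] i) ` {..<p}) = card (carrier (G Mod H))"
      using inj card carr by (simp add: card_image)
    ultimately show "(\<lambda>i. H #> \<sigma> [^] i) ` {..<p} = carrier (G Mod H)"
      using finQ by (simp add: card_subset_eq)
  qed (rule inj)
  assume g: "g \<in> carrier G"
  \<comment> \<open>Normality makes the left coset of \<sigma>^k a right coset, hence an element of
    the quotient, where existence and uniqueness of k can be read off from the bijection.\<close>
  have mem: "g \<in> (\<sigma> [^] k) <# H \<longleftrightarrow> H #> \<sigma> [^] k = H #> g" for k :: nat
    using g \<sigma> coset_eq rcos_self[OF g is_subgroup] repr_independence[OF _ _ is_subgroup]
    by (metis nat_pow_closed)
  from g have "H #> g \<in> carrier (G Mod H)" by (auto simp: carrier_FactGroup)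
  then obtain i where i: "i < p" "H #> g = H #> \<sigma> [^] i"
    using bij by (auto simp: bij_betw_def)
  show "\<exists>!k. k < p \<and> g \<in> (\<sigma> [^] k) <# H"
    unfolding mem i(2)
  proof (rule ex1I)
    fix k assume "k < p \<and> H #> \<sigma> [^] k = H #> \<sigma> [^] i"
    then show "k = i" using inj_onD[OF inj, of k i] i(1) by simp
  qed (use i(1) in simp)
qed

end

section \<open>The action on \<open>R\<close> and the norm of the quotient\<close>

context
  fixes G :: "('g, 'm) monoid_scheme" (structure) and R :: "('r, 'n) ring_scheme"
    and act :: "'g \<Rightarrow> 'r \<Rightarrow> 'r"
  assumes R: "ring R" and action: "ring_aut_action G R act"
begin

interpretation R: ring R by (rule R)
interpretation group_action G "carrier R" act
  using action by (simp add: ring_aut_action_def)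
interpretation G: group G
  using group_hom by (simp add: group_hom_def)

lemma act_closed: "g \<in> carrier G \<Longrightarrow> r \<in> carrier R \<Longrightarrow> act g r \<in> carrier R"
  by (rule element_image) auto

lemma act_ring_hom: "g \<in> carrier G \<Longrightarrow> act g \<in> ring_hom R R"
  using action by (simp add: ring_aut_action_def ring_iso_def)

lemma act_add:
  "g \<in> carrier G \<Longrightarrow> r \<in> carrier R \<Longrightarrow> s \<in> carrier R \<Longrightarrow> act g (r \<oplus>\<^bsub>R\<^esub> s) = act g r \<oplus>\<^bsub>R\<^esub> act g s"
  using act_ring_hom ring_hom_add by fastforce

lemma act_diff:
  assumes "g \<in> carrier G" "r \<in> carrier R" "s \<in> carrier R"
  shows "act g (r \<ominus>\<^bsub>R\<^esub> s) = act g r \<ominus>\<^bsub>R\<^esub> act g s"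
proof -
  have "act g (r \<ominus>\<^bsub>R\<^esub> s) \<oplus>\<^bsub>R\<^esub> act g s = act g r"
    using assms by (simp flip: act_add) (simp add: a_minus_def R.a_assoc R.l_neg)
  moreover have "act g (r \<ominus>\<^bsub>R\<^esub> s) \<in> carrier R" "act g s \<in> carrier R"
    using assms by (simp_all add: act_closed)
  ultimately show ?thesis
    by (metis R.add.inv_solve_right' R.minus_eq R.add.m_closed)
qed

text \<open>Normality allows h to be written as gu rather than ug; u then acts first and fixes
  x.\<close>

lemma coset_act_eq:
  assumes "U \<lhd> G" "x \<in> carrier R" "\<And>u. u \<in> U \<Longrightarrow> act u x = x"
    and "g \<in> carrier G" "h \<in> U #> g"
  shows "act h x = act g x"
proof -
  interpret U: normal U G by fact
  obtain u where "u \<in> U" "h = g \<otimes> u"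
    using assms(4,5) U.coset_eq by (auto simp: l_coset_def)
  then show ?thesis
    using composition_rule[OF assms(2,4), of u] assms(3) U.subset by auto
qed

text \<open>The representative chosen by \<open>quot_act\<close> does not affect its value on an
  invariant element, so any system of representatives computes the norm. The powers of \<sigma> will
  serve as \<open>t\<close>.\<close>

lemma quot_norm_eq:
  assumes U: "U \<lhd> G" and x: "x \<in> carrier R" and inv: "\<And>u. u \<in> U \<Longrightarrow> act u x = x"
    and t: "t \<in> I \<rightarrow> carrier G" and bij: "bij_betw (\<lambda>i. U #> t i) I (carrier (G Mod U))"
  shows "norm_map R (quot_act act) (carrier (G Mod U)) x = (\<Oplus>\<^bsub>R\<^esub>i\<in>I. act (t i) x)"
proof -
  interpret U: normal U G by fact
  have eq: "quot_act act (U #> t i) x = act (t i) x" if "i \<in> I" for i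
  proof -
    have "t i \<in> carrier G" using t that by blast
    moreover from this have "(SOME g. g \<in> U #> t i) \<in> U #> t i"
      using G.rcos_self U.is_subgroup by (metis someI)
    ultimately show ?thesis
      unfolding quot_act_def using coset_act_eq[OF U x inv] by blast
  qed
  have cl: "act (t i) x \<in> carrier R" if "i \<in> I" for i
    using t x that act_closed by blast
  have "norm_map R (quot_act act) (carrier (G Mod U)) x
      = (\<Oplus>\<^bsub>R\<^esub>C\<in>(\<lambda>i. U #> t i) ` I. quot_act act C x)"
    using bij by (simp add: norm_map_def bij_betw_def)
  also have "\<dots> = (\<Oplus>\<^bsub>R\<^esub>i\<in>I. quot_act act (U #> t i) x)"
    using bij eq cl by (subst R.finsum_reindex)
      (auto simp: bij_betw_def Pi_iff simp flip: bij_betw_imp_surj_on[OF bij])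
  also have "\<dots> = (\<Oplus>\<^bsub>R\<^esub>i\<in>I. act (t i) x)"
    using eq cl by (intro R.finsum_cong') auto
  finally show ?thesis .
qed

end

section \<open>Invariance and norm of the element \<open>a\<close>\<close>

theorem proposition4p4:
  fixes G :: "('g, 'm) monoid_scheme" and R :: "('r, 'n) ring_scheme"
    and act :: "'g \<Rightarrow> 'r \<Rightarrow> 'r" and p n :: nat and U :: "'g set" and \<sigma> :: 'g
    and b :: "'g \<Rightarrow> 'r" and w a :: 'r
  assumes "Factorial_Ring.prime p" and "group G" and "finite (carrier G)" and "order G = p ^ n"
    and "\<not> elementary_abelian G"
    and "ring R" and "ring_aut_action G R act"
    and "\<And>H. subgroup H G \<Longrightarrow> H \<noteq> carrier G \<Longrightarrow> \<exists>x\<in>carrier R. norm_map R act H x = \<one>\<^bsub>R\<^esub>"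
    and "U \<lhd> G" and "card (rcosets\<^bsub>G\<^esub> U) = p"
    and "\<sigma> \<in> carrier G" and "generate (G Mod U) {U #>\<^bsub>G\<^esub> \<sigma>} = carrier (G Mod U)"
    and "b \<in> carrier G \<rightarrow> carrier R"
    and "one_cocycle G (coind G R) (coind_act G R)
           (\<lambda>g. alpha_map G R U p \<sigma> g
                  \<otimes>\<^bsub>coind G R\<^esub> inv\<^bsub>coind G R\<^esub> (coind_embed G R act (b g)))"
    and "w \<in> carrier R" and "\<And>g. g \<in> U \<Longrightarrow> b g = act g w \<ominus>\<^bsub>R\<^esub> w"
    and "a = b \<sigma> \<oplus>\<^bsub>R\<^esub> (w \<ominus>\<^bsub>R\<^esub> act \<sigma> w)"
  shows "a \<in> carrier R \<and> (\<forall>u\<in>U. act u a = a) \<and>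
         norm_map R (quot_act act) (carrier (G Mod U)) a
           = (\<Oplus>\<^bsub>R\<^esub>i\<in>{..<p}. act (\<sigma> [^]\<^bsub>G\<^esub> i) a) \<and>
         (\<Oplus>\<^bsub>R\<^esub>i\<in>{..<p}. act (\<sigma> [^]\<^bsub>G\<^esub> i) a) = \<one>\<^bsub>R\<^esub>"
proof -
  note p = assms(1) and fin = assms(3) and R = assms(6) and action = assms(7) and U = assms(9)
    and card = assms(10) and \<sigma> = assms(11) and gen = assms(12) and bcl = assms(13)
    and coc = assms(14) and w = assms(15) and bU = assms(16) and a_eq = assms(17)
  interpret G: group G by fact
  interpret R: ring R by fact
  interpret U: normal U G by fact
  interpret group_action G "carrier R" act
    using action by (simp add: ring_aut_action_def)
  note grp = G.is_group
  note acl = act_closed[OF R action]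
  note exponent = U.cyclic_quotient_exponent[OF fin card \<sigma> gen]
  have p2: "2 \<le> p" using p by (rule prime_ge_2_nat)
  have Ucl: "u \<in> carrier G" if "u \<in> U" for u using that U.subset by blast
  let ?e = "\<lambda>P. if P then \<one>\<^bsub>R\<^esub> else \<zero>\<^bsub>R\<^esub>"
  define k where "k = coset_exp G U p \<sigma>"
  have k_eqI: "k g = j" if "g \<in> carrier G" "j < p" "g \<in> (\<sigma> [^]\<^bsub>G\<^esub> j) <#\<^bsub>G\<^esub> U" for g j
    unfolding k_def coset_exp_def using exponent(3)[OF that(1)] that(2,3) by (intro the1_equality) auto
  have k: "k g < p" "g \<in> (\<sigma> [^]\<^bsub>G\<^esub> k g) <#\<^bsub>G\<^esub> U" if "g \<in> carrier G" for g
    using theI'[OF exponent(3)[OF that]] unfolding k_def coset_exp_def by auto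
  have kU: "k u = 0" if "u \<in> U" for u
    using that p2 Ucl[OF that] by (intro k_eqI) (auto simp: l_coset_def)
  have k\<sigma>: "k \<sigma> = 1"
    using p2 \<sigma> by (intro k_eqI) (auto simp: l_coset_def intro!: bexI[of _ "\<one>\<^bsub>G\<^esub>"])
  have k0: "0 < k g" if "g \<in> carrier G" "g \<notin> U" for g
  proof (rule ccontr)
    assume "\<not> 0 < k g"
    with k(2)[OF that(1)] have "g \<in> \<one>\<^bsub>G\<^esub> <#\<^bsub>G\<^esub> U" by simp
    with that(2) show False
      using Ucl by (auto simp: l_coset_def)
  qed

  \<comment> \<open>Values of \<alpha> at basis vectors\<close>
  define \<phi> where "\<phi> = phi_elt G R U"
  have \<phi>: "\<phi> \<in> carrier (coind G R)"
    unfolding \<phi>_def phi_elt_def by (rule lin_ext_closed[OF grp R fin]) auto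
  have \<phi>_eval: "\<phi> (frag_of s) = ?e (s \<in> U)" if "s \<in> carrier G" for s
    unfolding \<phi>_def phi_elt_def by (subst lin_ext_frag_of[OF grp R that]) auto
  define A where "A = alpha_map G R U p \<sigma>"
  have A_eq: "A g = (\<Otimes>\<^bsub>coind G R\<^esub>i\<in>{..<k g}. coind_act G R (\<sigma> [^]\<^bsub>G\<^esub> i) \<phi>)" for g
    by (simp add: A_def alpha_map_def k_def \<phi>_def)
  have summand: "coind_act G R (\<sigma> [^]\<^bsub>G\<^esub> i) \<phi> \<in> carrier (coind G R)" for i :: nat
    using \<sigma> by (intro coind_act_closed[OF grp R \<phi>]) simp
  have Acl: "A g \<in> carrier (coind G R)" for g
    unfolding A_eq using summand
    by (intro comm_monoid.finprod_closed comm_group.axioms(1)[OF comm_group_coind[OF grp R]]) auto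
  \<comment> \<open>The translate of \<phi> by \<sigma>^i takes at s the value of \<phi> at
    s\<sigma>^i, so the sum counts the i < k(g) with s\<sigma>^i in U.\<close>
  have A_eval: "A g (frag_of s) = (\<Oplus>\<^bsub>R\<^esub>i\<in>{..<k g}. ?e (s \<otimes>\<^bsub>G\<^esub> \<sigma> [^]\<^bsub>G\<^esub> i \<in> U))"
    if s: "s \<in> carrier G" for g s
  proof -
    have "A g (frag_of s)
        = (\<Oplus>\<^bsub>R\<^esub>i\<in>{..<k g}. coind_act G R (\<sigma> [^]\<^bsub>G\<^esub> i) \<phi> (frag_of s))"
      unfolding A_eq using summand by (intro coind_eval_finprod[OF grp R s]) auto
    also have "\<dots> = (\<Oplus>\<^bsub>R\<^esub>i\<in>{..<k g}. ?e (s \<otimes>\<^bsub>G\<^esub> \<sigma> [^]\<^bsub>G\<^esub> i \<in> U))"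
      using s \<sigma> by (intro R.finsum_cong') (auto simp: coind_act_eval[OF grp R \<phi>] \<phi>_eval)
    finally show ?thesis .
  qed
  have A_U: "A u (frag_of s) = \<zero>\<^bsub>R\<^esub>" if "u \<in> U" "s \<in> carrier G" for u s
    using that by (simp add: A_eval kU)
  have A_\<sigma>: "A \<sigma> (frag_of s) = ?e (s \<in> U)" if "s \<in> carrier G" for s
    using that by (simp add: A_eval k\<sigma> lessThan_Suc)
  \<comment> \<open>Since k(g) < p, the only exponent i < k(g) with \<sigma>^i in U is i = 0. It
    lies in the range exactly when k(g) is positive, that is, when g is outside U.\<close>
  have A_one: "A g (frag_of \<one>\<^bsub>G\<^esub>) = ?e (g \<notin> U)" if g: "g \<in> carrier G" for g
  proof (cases "g \<in> U")
    case True
    then show ?thesis by (simp add: A_U)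
  next
    case False
    have "A g (frag_of \<one>\<^bsub>G\<^esub>) = (\<Oplus>\<^bsub>R\<^esub>i\<in>{..<k g}. if 0 = i then \<one>\<^bsub>R\<^esub> else \<zero>\<^bsub>R\<^esub>)"
      unfolding A_eval[OF G.one_closed]
    proof (intro R.finsum_cong')
      fix i assume "i \<in> {..<k g}"
      then have "p dvd i \<longleftrightarrow> 0 = i"
        using k(1)[OF g] by (auto dest: dvd_imp_le)
      then show "?e (\<one>\<^bsub>G\<^esub> \<otimes>\<^bsub>G\<^esub> \<sigma> [^]\<^bsub>G\<^esub> i \<in> U) = (if 0 = i then \<one>\<^bsub>R\<^esub> else \<zero>\<^bsub>R\<^esub>)"
        using \<sigma> by (simp add: exponent(2))
    qed auto
    also have "\<dots> = \<one>\<^bsub>R\<^esub>"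
      using k0[OF g False] by (intro R.finsum_singleton) auto
    finally show ?thesis using False by simp
  qed

  \<comment> \<open>The cocycle identity as an identity in \<open>R\<close>\<close>
  have embcl: "coind_embed G R act r \<in> carrier (coind G R)" if "r \<in> carrier R" for r
    unfolding coind_embed_def using that acl by (intro lin_ext_closed[OF grp R fin]) auto
  have emb_eval: "coind_embed G R act r (frag_of s) = act s r" if "r \<in> carrier R" "s \<in> carrier G" for r s
    unfolding coind_embed_def using that acl by (intro lin_ext_frag_of[OF grp R]) auto
  define \<beta> where "\<beta> g = A g \<otimes>\<^bsub>coind G R\<^esub> inv\<^bsub>coind G R\<^esub> (coind_embed G R act (b g))" for g
  have bclD: "b g \<in> carrier R" if "g \<in> carrier G" for g
    using bcl that by blast
  interpret B: comm_group "coind G R" by (rule comm_group_coind[OF grp R])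
  have \<beta>cl: "\<beta> g \<in> carrier (coind G R)" if "g \<in> carrier G" for g
    unfolding \<beta>_def using Acl embcl[OF bclD[OF that]] by (intro B.m_closed B.inv_closed)
  have \<beta>_eval: "\<beta> g (frag_of s) = A g (frag_of s) \<ominus>\<^bsub>R\<^esub> act s (b g)"
    if "g \<in> carrier G" "s \<in> carrier G" for g s
    unfolding \<beta>_def R.minus_eq
    using that embcl bclD
    by (simp add: coind_eval_mult[OF grp R] coind_eval_inv[OF grp R] emb_eval)
  have act1: "act \<one>\<^bsub>G\<^esub> r = r" if "r \<in> carrier R" for r
    using that id_eq_one by (metis restrict_apply')
  have Aev: "A g (frag_of s) \<in> carrier R" if "s \<in> carrier G" for g s
    using coindD(1)[OF grp R Acl] that by simp
  \<comment> \<open>At the unit, the translate of \<beta>(h) by g takes the value of \<beta>(h) at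
    g, and there the embedded element b(h) becomes g b(h).\<close>
  have coc1: "A (g \<otimes>\<^bsub>G\<^esub> h) (frag_of \<one>\<^bsub>G\<^esub>) \<ominus>\<^bsub>R\<^esub> b (g \<otimes>\<^bsub>G\<^esub> h)
      = (A g (frag_of \<one>\<^bsub>G\<^esub>) \<ominus>\<^bsub>R\<^esub> b g) \<oplus>\<^bsub>R\<^esub> (A h (frag_of g) \<ominus>\<^bsub>R\<^esub> act g (b h))"
    if gh: "g \<in> carrier G" "h \<in> carrier G" for g h
  proof -
    have "\<beta> (g \<otimes>\<^bsub>G\<^esub> h) = \<beta> g \<otimes>\<^bsub>coind G R\<^esub> coind_act G R g (\<beta> h)"
      using coc gh unfolding one_cocycle_def \<beta>_def A_def by blast
    then have "\<beta> (g \<otimes>\<^bsub>G\<^esub> h) (frag_of \<one>\<^bsub>G\<^esub>)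
        = \<beta> g (frag_of \<one>\<^bsub>G\<^esub>) \<oplus>\<^bsub>R\<^esub> \<beta> h (frag_of g)"
      using gh \<beta>cl by (simp add: coind_eval_mult[OF grp R] coind_act_eval[OF grp R])
    then show ?thesis
      using gh bclD by (simp add: \<beta>_eval act1)
  qed

  define d where "d g = b g \<ominus>\<^bsub>R\<^esub> (act g w \<ominus>\<^bsub>R\<^esub> w)" for g
  have dcl: "d g \<in> carrier R" if "g \<in> carrier G" for g
    using that w bclD acl by (simp add: d_def)
  \<comment> \<open>The carry is kept as three separate terms, moved across so that none has a minus
    sign; the ones occurring later can then be cancelled.\<close>
  have step: "d (g \<otimes>\<^bsub>G\<^esub> h) \<oplus>\<^bsub>R\<^esub> (A g (frag_of \<one>\<^bsub>G\<^esub>) \<oplus>\<^bsub>R\<^esub> A h (frag_of g))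
      = d g \<oplus>\<^bsub>R\<^esub> act g (d h) \<oplus>\<^bsub>R\<^esub> A (g \<otimes>\<^bsub>G\<^esub> h) (frag_of \<one>\<^bsub>G\<^esub>)"
    if gh: "g \<in> carrier G" "h \<in> carrier G" for g h
  proof -
    show ?thesis
      using R.coboundary_shift[OF coc1[OF gh], of w "act g w" "act (g \<otimes>\<^bsub>G\<^esub> h) w"] gh w bclD acl Aev
      by (simp add: d_def act_diff[OF R action] composition_rule)
  qed
  have dU: "d u = \<zero>\<^bsub>R\<^esub>" if "u \<in> U" for u
    using bU[OF that] acl[OF Ucl[OF that] w] w by (simp add: d_def R.minus_eq R.r_neg)
  have d\<sigma>: "d \<sigma> = a"
    unfolding a_eq d_def using w bclD[OF \<sigma>] acl[OF \<sigma> w]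
    by (simp add: R.minus_eq R.minus_add R.a_comm)
  have a: "a \<in> carrier R" using dcl[OF \<sigma>] d\<sigma> by simp
  have act0: "act g \<zero>\<^bsub>R\<^esub> = \<zero>\<^bsub>R\<^esub>" if "g \<in> carrier G" for g
    using ring_hom_zero[OF act_ring_hom[OF R action that] R R] .

  \<comment> \<open>Invariance under U\<close>
  have \<sigma>U: "\<sigma> \<notin> U"
    using exponent(2)[of 1] p2 \<sigma> by simp
  \<comment> \<open>In \<open>step\<close> for u and \<sigma>, both \<alpha>(\<sigma>)(u) and
    \<alpha>(u\<sigma>)(1) are 1 and cancel, while d(u) and \<alpha>(u)(1) are 0.\<close>
  have left: "d (u \<otimes>\<^bsub>G\<^esub> \<sigma>) = act u a" if u: "u \<in> U" for u
  proof -
    have uG: "u \<in> carrier G" using Ucl u .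
    have "u \<otimes>\<^bsub>G\<^esub> \<sigma> \<notin> U"
      using \<sigma>U u \<sigma> uG by (metis G.inv_solve_left U.m_closed U.m_inv_closed G.m_closed)
    then show ?thesis
      using step[OF uG \<sigma>] u uG \<sigma> a acl dcl
      by (simp add: A_one A_\<sigma> dU d\<sigma>)
  qed
  \<comment> \<open>Now the cancelling ones are \<alpha>(\<sigma>)(1) and \<alpha>(\<sigma>u)(1),
    while \<alpha>(u)(\<sigma>) and \<sigma> d(u) vanish.\<close>
  have right: "d (\<sigma> \<otimes>\<^bsub>G\<^esub> u) = a" if u: "u \<in> U" for u
  proof -
    have uG: "u \<in> carrier G" using Ucl u .
    have "\<sigma> \<otimes>\<^bsub>G\<^esub> u \<notin> U"
      using \<sigma>U u \<sigma> uG by (metis G.inv_solve_right U.m_closed U.m_inv_closed G.m_closed)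
    then show ?thesis
      using step[OF \<sigma> uG] u uG \<sigma> \<sigma>U a dcl
      by (simp add: A_one A_U dU d\<sigma> act0)
  qed
  have inv: "act u a = a" if u: "u \<in> U" for u
  proof -
    have "u \<otimes>\<^bsub>G\<^esub> \<sigma> \<in> \<sigma> <#\<^bsub>G\<^esub> U"
      using u \<sigma> U.coset_eq by (auto simp: r_coset_def)
    then obtain u' where "u' \<in> U" "u \<otimes>\<^bsub>G\<^esub> \<sigma> = \<sigma> \<otimes>\<^bsub>G\<^esub> u'"
      by (auto simp: l_coset_def)
    then show ?thesis
      using left[OF u] right by metis
  qed

  \<comment> \<open>The norm along the powers of \<sigma>\<close>
  let ?S = "\<lambda>j. \<Oplus>\<^bsub>R\<^esub>i\<in>{..<j}. act (\<sigma> [^]\<^bsub>G\<^esub> i) a"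
  have pw: "\<sigma> [^]\<^bsub>G\<^esub> i \<in> carrier G" for i :: nat
    using \<sigma> by simp
  have Scl: "?S j \<in> carrier R" for j :: nat
    using acl[OF pw a] by (intro R.finsum_closed) auto
  have SSuc: "?S (Suc j) = ?S j \<oplus>\<^bsub>R\<^esub> act (\<sigma> [^]\<^bsub>G\<^esub> j) a" for j :: nat
    unfolding lessThan_Suc using acl[OF pw a] Scl by (subst R.finsum_insert) (auto simp: R.a_comm)
  \<comment> \<open>The left summand 1 is \<alpha>(\<sigma>^j)(1) + \<alpha>(\<sigma>)(\<sigma>^j):
    the first term is the indicator that p does not divide j, the second that it does.\<close>
  have pow_step: "d (\<sigma> [^]\<^bsub>G\<^esub> Suc j) \<oplus>\<^bsub>R\<^esub> \<one>\<^bsub>R\<^esub>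
      = d (\<sigma> [^]\<^bsub>G\<^esub> j) \<oplus>\<^bsub>R\<^esub> act (\<sigma> [^]\<^bsub>G\<^esub> j) a \<oplus>\<^bsub>R\<^esub> ?e (\<not> p dvd Suc j)" for j :: nat
    using step[OF pw \<sigma>, of j] pw[of "Suc j"] pw[of j]
    by (simp only: A_one A_\<sigma> d\<sigma> exponent(2) G.nat_pow_Suc[symmetric])
      (cases "p dvd j"; simp)
  have partial: "d (\<sigma> [^]\<^bsub>G\<^esub> j) = ?S j" if "j < p" for j :: nat
    using that
  proof (induction j)
    case 0
    then show ?case using dU[OF U.one_closed] by simp
  next
    case (Suc j)
    then have "\<not> p dvd Suc j" by (auto dest: dvd_imp_le)
    then have "d (\<sigma> [^]\<^bsub>G\<^esub> Suc j) \<oplus>\<^bsub>R\<^esub> \<one>\<^bsub>R\<^esub> = ?S (Suc j) \<oplus>\<^bsub>R\<^esub> \<one>\<^bsub>R\<^esub>"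
      using pow_step[of j] Suc by (simp only: SSuc) simp
    then show ?case
      using R.add.right_cancel[OF R.one_closed dcl[OF pw] Scl] by blast
  qed
  have "?S p = \<one>\<^bsub>R\<^esub>"
  proof -
    obtain m where m: "p = Suc m" using p2 by (cases p) auto
    then have "m < p" by simp
    have "d (\<sigma> [^]\<^bsub>G\<^esub> p) = \<zero>\<^bsub>R\<^esub>"
      using exponent(2)[of p] by (intro dU) simp
    \<comment> \<open>At j = p - 1 the indicator in \<open>pow_step\<close> becomes 0 while the 1 on
      the left remains; this unmatched 1 is the value of the norm.\<close>
    moreover have "d (\<sigma> [^]\<^bsub>G\<^esub> p) \<oplus>\<^bsub>R\<^esub> \<one>\<^bsub>R\<^esub> = ?S p \<oplus>\<^bsub>R\<^esub> \<zero>\<^bsub>R\<^esub>"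
      using pow_step[of m] partial[OF \<open>m < p\<close>] SSuc[of m] by (simp flip: m del: G.nat_pow_Suc)
    ultimately have "\<zero>\<^bsub>R\<^esub> \<oplus>\<^bsub>R\<^esub> \<one>\<^bsub>R\<^esub> = ?S p \<oplus>\<^bsub>R\<^esub> \<zero>\<^bsub>R\<^esub>"
      by (simp only:)
    then show ?thesis using Scl by simp
  qed
  moreover have "norm_map R (quot_act act) (carrier (G Mod U)) a = ?S p"
    using pw by (intro quot_norm_eq[OF R action U a inv _ exponent(1)]) auto
  ultimately show ?thesis
    using a inv by simp
qed

end
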